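(* Let $G$ be a connected graph of order $n$ and let $e$ be an edge not in $E(G)$ (joining two nonadjacent vertices of $G$). Let $\lambda_1\ge\cdots\ge\lambda_n$ be the Laplacian matching roots of $G$. Then it is impossible that the multiset of Laplacian matching roots of $G+e$ equals $\{\lambda_1,\ldots,\lambda_n\}$ with exactly one entry $\lambda_t$ replaced by $\lambda_t+2$ (and all other entries unchanged). That is, the Laplacian matching root integral variation never occurs in one place.
   Context: All graphs are finite, simple and undirected. For a graph $G$ with vertex set $V(G)$, let $d(v)$ denote the degree of $v$ and $\mathcal{M}(G)$ the set of matchings of $G$ (including the empty matching); for a matching $M$, $V(M)$ is the set of endpoints of edges in $M$. The Laplacian matching polynomial of $G$ is $\mathscr{LM}(G,x)=\sum_{M\in\mathcal{M}(G)}(-1)^{|M|}\prod_{v\in V(G)\setminus V(M)}(x-d(v))$. All its roots are real and nonnegative; they are called the Laplacian matching roots of $G$ and are listed with multiplicity as $\lambda_1\ge\cdots\ge\lambda_n\ge 0$. $G+e$ denotes the graph obtained by adding the new edge $e$. "LMRIV occurs in one place" means the roots of $G+e$ are obtained from those of $G$ by increasing one root by $2$ and leaving the other $n-1$ unchanged. *)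

theory Defs
  imports "HOL-Computational_Algebra.Computational_Algebra"
begin

definition simple_graph :: "'a set \<Rightarrow> 'a set set \<Rightarrow> bool" where
  "simple_graph V E \<longleftrightarrow> finite V \<and> E \<subseteq> {e. e \<subseteq> V \<and> card e = 2}"

definition connected_graph :: "'a set \<Rightarrow> 'a set set \<Rightarrow> bool" where
  "connected_graph V E \<longleftrightarrow>
     V \<noteq> {} \<and> (\<forall>x\<in>V. \<forall>y\<in>V. (x, y) \<in> {(a, b). {a, b} \<in> E}\<^sup>*)"

definition degree_of :: "'a set set \<Rightarrow> 'a \<Rightarrow> nat" where
  "degree_of E v = card {e \<in> E. v \<in> e}"

definition matchings :: "'a set set \<Rightarrow> 'a set set set" where
  "matchings E = {M. M \<subseteq> E \<and> pairwise disjnt M}"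

definition laplacian_matching_poly :: "'a set \<Rightarrow> 'a set set \<Rightarrow> real poly" where
  "laplacian_matching_poly V E =
     (\<Sum>M\<in>matchings E. (-1) ^ card M * (\<Prod>v\<in>V - \<Union>M. [:- real (degree_of E v), 1:]))"

(* The real roots, repeated according to multiplicity, in non-increasing order.  The Laplacian
   matching polynomial has only real roots, so for a simple graph this list has length card V. *)
definition laplacian_matching_roots :: "'a set \<Rightarrow> 'a set set \<Rightarrow> real list" where
  "laplacian_matching_roots V E =
     rev (sorted_list_of_multiset (proots (laplacian_matching_poly V E)))"

end

theory Submission
  imports Defs
begin

text \<open>
  Write \<open>P\<close> for the Laplacian matching polynomial of \<open>G\<close>, and \<open>P\<^sub>u\<close> for the polynomial obtained
  by deleting \<open>u\<close> while keeping the vertex weights \<open>x - d(w)\<close> of \<open>G\<close>. Adding the edge \<open>e = uv\<close>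
  turns \<open>P\<close> into \<open>P - P\<^sub>u - P\<^sub>v\<close>. All roots being real (the Heilmann--Lieb argument in the upper half
  plane), integral variation in one place means \<open>P = (x - \<lambda>) Q\<close> and \<open>P\<^sub>u + P\<^sub>v = 2 Q\<close>.
  By the recursion at a vertex, \<open>P\<^sub>u / P = 1/x + d(u)/x\<^sup>2 + (d(u)\<^sup>2 + d(u))/x\<^sup>3 + \<dots>\<close>, and comparison
  with \<open>2/(x - \<lambda>)\<close> gives \<open>2 \<lambda> = d(u) + d(v)\<close> and
  \<open>2 \<lambda>\<^sup>2 = d(u)\<^sup>2 + d(v)\<^sup>2 + d(u) + d(v)\<close>, hence \<open>d(u) = d(v) = 0\<close>, contradicting connectedness.
\<close>

section \<open>Weighted matching polynomials and their recursions\<close>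

text \<open>The weights are independent of the edges, so shrinking \<open>A\<close> deletes vertices
  while the degrees of the original graph are kept. The general ring covers both real polynomials
  and their values at complex points.\<close>

definition weighted_matching_poly :: "('a \<Rightarrow> 'b::comm_ring_1) \<Rightarrow> 'a set set \<Rightarrow> 'a set \<Rightarrow> 'b" where
  "weighted_matching_poly f E A =
     (\<Sum>M\<in>matchings {d \<in> E. d \<subseteq> A}. (-1) ^ card M * (\<Prod>v\<in>A - \<Union>M. f v))"

lemma weighted_matching_poly_cong:
  assumes "\<And>v. v \<in> A \<Longrightarrow> f v = g v" and "\<And>d. d \<subseteq> A \<Longrightarrow> d \<in> E \<longleftrightarrow> d \<in> F"
  shows "weighted_matching_poly f E A = weighted_matching_poly g F A"
proof -
  have "{d \<in> E. d \<subseteq> A} = {d \<in> F. d \<subseteq> A}"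
    using assms(2) by auto
  then show ?thesis
    unfolding weighted_matching_poly_def by (auto intro!: sum.cong prod.cong simp: assms(1))
qed

lemma matchings_insert:
  assumes "e \<notin> E"
  shows "matchings (insert e E) = matchings E \<union> insert e ` matchings {d \<in> E. disjnt d e}"
proof (intro set_eqI iffI)
  fix M assume M: "M \<in> matchings (insert e E)"
  show "M \<in> matchings E \<union> insert e ` matchings {d \<in> E. disjnt d e}"
  proof (cases "e \<in> M")
    case True
    have "M - {e} \<in> matchings {d \<in> E. disjnt d e}"
      using M True unfolding matchings_def pairwise_def by blast
    moreover have "M = insert e (M - {e})"
      using True by auto
    ultimately show ?thesis
      by blast
  next
    case False
    then show ?thesis
      using M unfolding matchings_def by blast
  qed
next
  fix M assume "M \<in> matchings E \<union> insert e ` matchings {d \<in> E. disjnt d e}"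
  then show "M \<in> matchings (insert e E)"
    unfolding matchings_def pairwise_def disjnt_def by blast
qed

text \<open>The matchings that use \<open>e\<close> arise by inserting \<open>e\<close> into a
  matching inside \<open>A - e\<close>; the extra edge flips the sign.\<close>

lemma weighted_matching_poly_insert_edge:
  assumes "finite A" "e \<subseteq> A" "e \<noteq> {}" "e \<notin> E"
  shows "weighted_matching_poly f (insert e E) A =
    weighted_matching_poly f E A - weighted_matching_poly f E (A - e)"
proof -
  define E' where "E' = {d \<in> E. d \<subseteq> A}"
  define E'' where "E'' = {d \<in> E. d \<subseteq> A - e}"
  define g where "g M = (-1) ^ card M * (\<Prod>v\<in>A - \<Union>M. f v)" for M
  have fin: "finite E'" "finite E''"
    using assms(1) by (auto simp: E'_def E''_def)
  have fin_matchings: "finite (matchings F)" if "finite F" for F :: "'a set set"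
    using that by (auto simp: matchings_def)
  have "{d \<in> insert e E. d \<subseteq> A} = insert e E'"
    using assms by (auto simp: E'_def)
  moreover have "{d \<in> E'. disjnt d e} = E''"
    by (auto simp: E'_def E''_def disjnt_def)
  ultimately have "matchings {d \<in> insert e E. d \<subseteq> A} = matchings E' \<union> insert e ` matchings E''"
    using matchings_insert[of e E'] assms(4) by (simp add: E'_def)
  moreover have "matchings E' \<inter> insert e ` matchings E'' = {}"
    using assms(4) by (auto simp: matchings_def E'_def)
  ultimately have "weighted_matching_poly f (insert e E) A =
      sum g (matchings E') + sum g (insert e ` matchings E'')"
    unfolding weighted_matching_poly_def g_def by (simp add: sum.union_disjoint fin_matchings fin)
  moreover have "inj_on (insert e) (matchings E'')"
    using assms(4) by (auto simp: matchings_def E''_def inj_on_def)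
  then have "sum g (insert e ` matchings E'') = (\<Sum>M\<in>matchings E''. g (insert e M))"
    by (simp add: sum.reindex)
  moreover have "g (insert e M) = - ((-1) ^ card M * (\<Prod>v\<in>(A - e) - \<Union>M. f v))"
    if "M \<in> matchings E''" for M
  proof -
    have "finite M" "e \<notin> M"
      using that fin assms(4) by (auto simp: matchings_def E''_def intro: finite_subset)
    moreover have "A - \<Union>(insert e M) = (A - e) - \<Union>M"
      by auto
    ultimately show ?thesis
      by (simp add: g_def)
  qed
  ultimately show ?thesis
    by (simp add: weighted_matching_poly_def g_def E'_def E''_def sum_negf)
qed

lemma weighted_matching_poly_isolated:
  assumes "finite A" "u \<in> A" "\<And>d. d \<in> E \<Longrightarrow> u \<notin> d"
  shows "weighted_matching_poly f E A = f u * weighted_matching_poly f E (A - {u})"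
proof -
  have edges: "{d \<in> E. d \<subseteq> A} = {d \<in> E. d \<subseteq> A - {u}}"
    using assms(3) by auto
  have "(\<Prod>v\<in>A - \<Union>M. f v) = f u * (\<Prod>v\<in>A - {u} - \<Union>M. f v)"
    if "M \<in> matchings {d \<in> E. d \<subseteq> A - {u}}" for M
  proof -
    have "A - \<Union>M = insert u (A - {u} - \<Union>M)"
      using that assms by (auto simp: matchings_def)
    then show ?thesis
      using assms(1) by simp
  qed
  then show ?thesis
    unfolding weighted_matching_poly_def edges by (simp add: sum_distrib_left algebra_simps)
qed

text \<open>Start with \<open>u\<close> isolated and add its edges one at a time. Each new edge
  \<open>d\<close> subtracts the polynomial of \<open>A - d\<close>, which does not see the other
  edges at \<open>u\<close> because \<open>u\<close> lies in \<open>d\<close>.\<close>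

lemma weighted_matching_poly_vertex:
  assumes "finite A" "u \<in> A"
  shows "weighted_matching_poly f E A = f u * weighted_matching_poly f E (A - {u}) -
    (\<Sum>d\<in>{d \<in> E. d \<subseteq> A \<and> u \<in> d}. weighted_matching_poly f E (A - d))"
proof -
  define E0 where "E0 = {d \<in> E. u \<notin> d}"
  have E0_poly: "weighted_matching_poly f E B = weighted_matching_poly f E0 B" if "u \<notin> B" for B
    using that by (intro weighted_matching_poly_cong) (auto simp: E0_def)
  have step: "weighted_matching_poly f (E0 \<union> F) A = f u * weighted_matching_poly f E (A - {u}) -
    (\<Sum>d\<in>F. weighted_matching_poly f E (A - d))"
    if "finite F" "F \<subseteq> {d \<in> E. d \<subseteq> A \<and> u \<in> d}" for F
    using that
  proof (induction F rule: finite_induct)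
    case empty
    have "weighted_matching_poly f E0 A = f u * weighted_matching_poly f E0 (A - {u})"
      using assms by (intro weighted_matching_poly_isolated) (auto simp: E0_def)
    then show ?case
      by (simp add: E0_poly)
  next
    case (insert d F)
    have "weighted_matching_poly f (insert d (E0 \<union> F)) A = weighted_matching_poly f (E0 \<union> F) A -
        weighted_matching_poly f (E0 \<union> F) (A - d)"
      using assms insert by (intro weighted_matching_poly_insert_edge) (auto simp: E0_def)
    moreover have "weighted_matching_poly f (E0 \<union> F) (A - d) = weighted_matching_poly f E (A - d)"
      using insert.prems by (intro weighted_matching_poly_cong) (auto simp: E0_def)
    ultimately show ?case
      using insert by simp
  qed
  have "weighted_matching_poly f E A =
      weighted_matching_poly f (E0 \<union> {d \<in> E. d \<subseteq> A \<and> u \<in> d}) A"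
    by (intro weighted_matching_poly_cong) (auto simp: E0_def)
  also have "\<dots> = f u * weighted_matching_poly f E (A - {u}) -
    (\<Sum>d\<in>{d \<in> E. d \<subseteq> A \<and> u \<in> d}. weighted_matching_poly f E (A - d))"
    using assms(1) by (intro step) auto
  finally show ?thesis .
qed

text \<open>In the recursion at \<open>u\<close> the weight \<open>f u\<close> occurs only once,
  linearly. This accounts for the rise of a degree by one when an edge is added.\<close>

lemma weighted_matching_poly_shift:
  assumes "finite A" "u \<in> A"
  shows "weighted_matching_poly (f(u := f u - 1)) E A =
    weighted_matching_poly f E A - weighted_matching_poly f E (A - {u})"
proof -
  have "weighted_matching_poly (f(u := f u - 1)) E B = weighted_matching_poly f E B" if "u \<notin> B" for B
    using that by (intro weighted_matching_poly_cong) auto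
  then show ?thesis
    by (simp add: weighted_matching_poly_vertex[OF assms] algebra_simps)
qed

lemma weighted_matching_poly_empty [simp]:
  assumes "{} \<notin> E"
  shows "weighted_matching_poly f E {} = 1"
proof -
  have "{d \<in> E. d \<subseteq> {}} = {}"
    using assms by auto
  then have "matchings {d \<in> E. d \<subseteq> {}} = {{}}"
    by (auto simp: matchings_def)
  then show ?thesis
    by (simp add: weighted_matching_poly_def)
qed

lemma edge_obtain_other:
  assumes "card d = 2" "u \<in> d"
  obtains w where "d = {u, w}" "w \<noteq> u"
  using assms by (auto simp: card_2_iff)

section \<open>Degree and leading coefficient\<close>

text \<open>In the recursion at a vertex only the product with the linear weight reaches degree
  \<open>card A\<close>; the edge terms, collected in \<open>S\<close>, stay below it.\<close>

lemma monic_weighted_matching_poly: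
  fixes w :: "'a \<Rightarrow> real"
  assumes "finite A" "\<And>d. d \<in> E \<Longrightarrow> card d = 2"
  defines "p \<equiv> weighted_matching_poly (\<lambda>v. [:- w v, 1:]) E"
  shows "degree (p A) = card A \<and> coeff (p A) (card A) = 1"
  using assms(1)
proof (induction "card A" arbitrary: A rule: less_induct)
  case less
  show ?case
  proof (cases "A = {}")
    case True
    have "{} \<notin> E"
      using assms(2) by force
    then show ?thesis
      using True by (simp add: p_def)
  next
    case False
    then obtain u where u: "u \<in> A"
      by blast
    define S where "S = (\<Sum>d\<in>{d \<in> E. d \<subseteq> A \<and> u \<in> d}. p (A - d))"
    have pA: "p A = [:- w u, 1:] * p (A - {u}) - S"
      unfolding p_def S_def using weighted_matching_poly_vertex[OF less.prems u] .
    have card_u: "card A = Suc (card (A - {u}))"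
      using u less.prems by (metis card_Suc_Diff1)
    then have IH: "degree (p (A - {u})) = card (A - {u})" "coeff (p (A - {u})) (card (A - {u})) = 1"
      using less by auto
    have "p (A - {u}) \<noteq> 0"
      using IH(2) by force
    then have deg: "degree ([:- w u, 1:] * p (A - {u})) = card A"
      using IH(1) card_u by (subst degree_mult_eq) auto
    have "degree (p (A - d)) \<le> card (A - {u})" if "d \<in> {d \<in> E. d \<subseteq> A \<and> u \<in> d}" for d
    proof -
      have "card (A - d) \<le> card (A - {u})"
        using that less.prems by (intro card_mono) auto
      then show ?thesis
        using less.hyps[of "A - d"] less.prems card_u by auto
    qed
    then have "degree S \<le> card (A - {u})"
      unfolding S_def using less.prems by (intro degree_sum_le) auto
    then have deg_S: "degree S < card A"
      using card_u by simp
    then have "coeff (p A) (card A) = 1"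
      using IH by (simp add: pA card_u coeff_eq_0)
    moreover have "degree (p A) \<le> card A"
      unfolding pA using deg deg_S by (intro degree_diff_le) auto
    ultimately show ?thesis
      by (metis le_antisym le_degree zero_neq_one)
  qed
qed

section \<open>Nonvanishing in the upper half plane\<close>

text \<open>The Heilmann--Lieb induction: dividing the recursion at \<open>u\<close> by
  \<open>p (A - {u})\<close> gives \<open>f u\<close> minus reciprocals of ratios for the smaller
  set \<open>A - {u}\<close>. Those ratios lie in the upper half plane, so subtracting their
  reciprocals only raises the imaginary part.\<close>

lemma Im_weighted_matching_poly_ratio:
  fixes f :: "'a \<Rightarrow> complex"
  assumes "finite A" "\<And>d. d \<in> E \<Longrightarrow> card d = 2" "\<And>v. Im (f v) > 0"
  defines "p \<equiv> weighted_matching_poly f E"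
  shows "p A \<noteq> 0 \<and> (\<forall>u\<in>A. Im (p A / p (A - {u})) > 0)"
  using assms(1)
proof (induction "card A" arbitrary: A rule: less_induct)
  case less
  have ratio: "Im (p A / p (A - {u})) > 0" if u: "u \<in> A" for u
  proof -
    have smaller: "card (A - {u}) < card A"
      using card_Diff1_less[OF less.prems u] .
    have nz: "p (A - {u}) \<noteq> 0"
      using less.hyps[OF smaller] less.prems by auto
    have neg: "Im (p (A - d) / p (A - {u})) \<le> 0" if d: "d \<in> {d \<in> E. d \<subseteq> A \<and> u \<in> d}" for d
    proof -
      obtain v where v: "d = {u, v}" "v \<noteq> u"
        using edge_obtain_other[of d u] assms(2)[of d] d by auto
      then have "v \<in> A - {u}"
        using d by auto
      then have "Im (p (A - {u}) / p (A - {u} - {v})) > 0"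
        using less.hyps[OF smaller] less.prems by auto
      moreover have "A - {u} - {v} = A - d"
        using v by auto
      ultimately show ?thesis
        by (simp add: Im_complex_div_gt_0 Im_complex_div_le_0 algebra_simps)
    qed
    have "p A / p (A - {u}) = f u - (\<Sum>d\<in>{d \<in> E. d \<subseteq> A \<and> u \<in> d}. p (A - d) / p (A - {u}))"
      using nz weighted_matching_poly_vertex[OF less.prems u, of f E]
      by (simp add: p_def diff_divide_distrib sum_divide_distrib)
    then have "Im (p A / p (A - {u})) =
        Im (f u) - (\<Sum>d\<in>{d \<in> E. d \<subseteq> A \<and> u \<in> d}. Im (p (A - d) / p (A - {u})))"
      by simp
    moreover have "(\<Sum>d\<in>{d \<in> E. d \<subseteq> A \<and> u \<in> d}. Im (p (A - d) / p (A - {u}))) \<le> 0"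
      using neg by (rule sum_nonpos)
    ultimately show ?thesis
      using assms(3)[of u] by linarith
  qed
  moreover have "p A \<noteq> 0"
  proof (cases "A = {}")
    case True
    have "{} \<notin> E"
      using assms(2) by force
    then show ?thesis
      using True by (simp add: p_def)
  next
    case False
    \<comment> \<open>If \<open>p A\<close> were zero, the ratio at any vertex of \<open>A\<close>
      would be zero, contradicting its positive imaginary part.\<close>
    then show ?thesis
      using ratio by fastforce
  qed
  ultimately show ?case
    by blast
qed

section \<open>Passage to complex polynomials and splitting over the reals\<close>

lemma map_poly_of_real_add:
  "map_poly complex_of_real (p + q) = map_poly of_real p + map_poly of_real q"
  by (rule poly_eqI) (simp add: coeff_map_poly)

lemma map_poly_of_real_mult:
  "map_poly complex_of_real (p * q) = map_poly of_real p * map_poly of_real q"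
  by (rule poly_eqI) (simp add: coeff_map_poly coeff_mult)

lemma map_poly_of_real_sum:
  "map_poly complex_of_real (\<Sum>x\<in>A. f x) = (\<Sum>x\<in>A. map_poly of_real (f x))"
  by (induction A rule: infinite_finite_induct) (auto simp: map_poly_of_real_add)

lemma map_poly_of_real_prod:
  "map_poly complex_of_real (\<Prod>x\<in>A. f x) = (\<Prod>x\<in>A. map_poly of_real (f x))"
  by (induction A rule: infinite_finite_induct) (auto simp: map_poly_of_real_mult)

lemma map_poly_of_real_power:
  "map_poly complex_of_real (p ^ k) = map_poly of_real p ^ k"
  by (induction k) (auto simp: map_poly_of_real_mult)

lemma map_poly_of_real_neg_1: "map_poly complex_of_real (- 1) = - 1"
  by (rule poly_eqI) (simp add: coeff_map_poly)

text \<open>Evaluation turns the linear weights into complex numbers with imaginary part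
  \<open>Im z\<close>, to which the half-plane argument applies.\<close>

lemma poly_weighted_matching_poly_complex:
  "poly (map_poly complex_of_real (weighted_matching_poly (\<lambda>v. [:- w v, 1:]) E A)) z =
    weighted_matching_poly (\<lambda>v. z - of_real (w v)) E A"
  unfolding weighted_matching_poly_def
  by (simp add: map_poly_of_real_sum map_poly_of_real_mult map_poly_of_real_prod
      map_poly_of_real_power map_poly_of_real_neg_1 poly_sum poly_prod map_poly_pCons)

text \<open>The roots of a real polynomial are closed under conjugation, so a zero-free upper half
  plane leaves only real roots; linear factors are then split off by induction on the
  degree.\<close>

lemma prod_proots_of_upper_half_plane_nonzero:
  fixes p :: "real poly"
  assumes "\<And>z. Im z > 0 \<Longrightarrow> poly (map_poly complex_of_real p) z \<noteq> 0"
  shows "p = smult (lead_coeff p) (\<Prod>x\<in>#proots p. [:-x, 1:])"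
  using assms
proof (induction "degree p" arbitrary: p)
  case 0
  then obtain c where "p = [:c:]"
    by (metis degree_0_id)
  then show ?case
    by simp
next
  case (Suc k)
  have deg: "degree (map_poly complex_of_real p) = Suc k"
    using Suc.hyps by (simp add: degree_map_poly)
  then have "\<not> constant (poly (map_poly complex_of_real p))"
    by (simp add: constant_degree)
  then obtain z where z: "poly (map_poly complex_of_real p) z = 0"
    using fundamental_theorem_of_algebra by blast
  have "map_poly cnj (map_poly complex_of_real p) = map_poly complex_of_real p"
    by (rule poly_eqI) (simp add: coeff_map_poly)
  then have "poly (map_poly complex_of_real p) (cnj z) = 0"
    using z by (metis complex_cnj_zero poly_cnj)
  \<comment> \<open>One of \<open>z\<close> and \<open>cnj z\<close> would otherwise be a root in
    the upper half plane.\<close>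
  then have "Im z = 0"
    using z Suc.prems[of z] Suc.prems[of "cnj z"] by fastforce
  then have "z = of_real (Re z)"
    by (simp add: complex_eq_iff)
  moreover have "poly (map_poly complex_of_real p) (of_real x) = of_real (poly p x)" for x
    by (induction p) (auto simp: map_poly_pCons)
  ultimately have "poly p (Re z) = 0"
    using z by (metis of_real_eq_0_iff)
  then obtain q where q: "p = [:- Re z, 1:] * q"
    by (metis dvdE poly_eq_0_iff_dvd)
  have "p \<noteq> 0"
    using Suc.hyps by auto
  then have "q \<noteq> 0"
    using q by auto
  have "k = degree q"
    using Suc.hyps q \<open>q \<noteq> 0\<close> by (simp add: degree_mult_eq del: mult_pCons_left)
  moreover have "poly (map_poly complex_of_real q) y \<noteq> 0" if "Im y > 0" for y
    using Suc.prems[OF that] unfolding q map_poly_of_real_mult by simp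
  ultimately have IH: "q = smult (lead_coeff q) (\<Prod>x\<in>#proots q. [:-x, 1:])"
    by (rule Suc.hyps(1))
  have "lead_coeff p = lead_coeff q"
    unfolding q by (simp add: lead_coeff_mult del: mult_pCons_left)
  moreover have "proots p = add_mset (Re z) (proots q)"
    unfolding q using \<open>q \<noteq> 0\<close> by (subst proots_mult) auto
  ultimately have "smult (lead_coeff p) (\<Prod>x\<in>#proots p. [:-x, 1:]) =
      [:- Re z, 1:] * smult (lead_coeff q) (\<Prod>x\<in>#proots q. [:-x, 1:])"
    by (simp del: mult_pCons_left)
  also have "\<dots> = p"
    unfolding IH[symmetric] by (simp only: q)
  finally show ?case ..
qed

section \<open>The Laplacian matching polynomial of a graph and of its one-edge extension\<close>

lemma laplacian_matching_poly_conv_weighted: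
  assumes "simple_graph V E"
  shows "laplacian_matching_poly V E =
    weighted_matching_poly (\<lambda>v. [:- real (degree_of E v), 1:]) E V"
proof -
  have "{d \<in> E. d \<subseteq> V} = E"
    using assms by (auto simp: simple_graph_def)
  then show ?thesis
    by (simp add: laplacian_matching_poly_def weighted_matching_poly_def)
qed

lemma laplacian_matching_poly_monic:
  assumes "simple_graph V E"
  shows "degree (laplacian_matching_poly V E) = card V"
    and "coeff (laplacian_matching_poly V E) (card V) = 1"
proof -
  have "finite V" "\<And>d. d \<in> E \<Longrightarrow> card d = 2"
    using assms by (auto simp: simple_graph_def)
  from monic_weighted_matching_poly[OF this]
  show "degree (laplacian_matching_poly V E) = card V"
    and "coeff (laplacian_matching_poly V E) (card V) = 1"
    by (simp_all add: laplacian_matching_poly_conv_weighted[OF assms])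
qed

lemma laplacian_matching_poly_eq_prod_roots:
  assumes "simple_graph V E"
  shows "laplacian_matching_poly V E =
    (\<Prod>x\<in>#mset (laplacian_matching_roots V E). [:-x, 1:])"
proof -
  have graph: "finite V" "\<And>d. d \<in> E \<Longrightarrow> card d = 2"
    using assms by (auto simp: simple_graph_def)
  have "poly (map_poly complex_of_real (laplacian_matching_poly V E)) z \<noteq> 0" if "Im z > 0" for z
    unfolding laplacian_matching_poly_conv_weighted[OF assms] poly_weighted_matching_poly_complex
    using Im_weighted_matching_poly_ratio[OF graph, where f = "\<lambda>v. z - of_real (real (degree_of E v))"] that
    by simp
  from prod_proots_of_upper_half_plane_nonzero[OF this] show ?thesis
    using laplacian_matching_poly_monic[OF assms] by (simp add: laplacian_matching_roots_def)
qed

text \<open>Comparing degrees in the factorization shows that no root is missing, so every index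
  below \<open>card V\<close> is a valid list position.\<close>

lemma length_laplacian_matching_roots:
  assumes "simple_graph V E"
  shows "length (laplacian_matching_roots V E) = card V"
proof -
  have "degree (\<Prod>x\<in>#A. [:-x, 1:]) = size A" for A :: "real multiset"
  proof (induction A)
    case (add x A)
    have "(\<Prod>x\<in>#A. [:-x, 1:]) \<noteq> 0"
      by (auto simp: prod_mset_zero_iff)
    then show ?case
      using add by (simp add: degree_mult_eq del: mult_pCons_left)
  qed simp
  from this[of "mset (laplacian_matching_roots V E)"] show ?thesis
    using laplacian_matching_poly_monic(1)[OF assms]
    by (simp flip: laplacian_matching_poly_eq_prod_roots[OF assms])
qed

text \<open>Lowering the weights of both endpoints by one produces the extra term
  \<open>p (V - {u, v})\<close>, which cancels exactly against the contribution of the matchings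
  through the new edge.\<close>

lemma laplacian_matching_poly_insert_edge:
  fixes V :: "'a set"
  assumes "simple_graph V E" "{u, v} \<subseteq> V" "u \<noteq> v" "{u, v} \<notin> E"
  defines "p \<equiv> weighted_matching_poly (\<lambda>x. [:- real (degree_of E x), 1:]) E"
  shows "laplacian_matching_poly V (insert {u, v} E) = p V - p (V - {u}) - p (V - {v})"
proof -
  define f where "f x = [:- real (degree_of E x), 1:]" for x
  define f' where "f' = f(u := f u - 1)"
  define g where "g = f'(v := f' v - 1)"
  have "finite V"
    using assms(1) by (simp add: simple_graph_def)
  have "E \<subseteq> Pow V"
    using assms(1) by (auto simp: simple_graph_def)
  then have "finite E"
    using \<open>finite V\<close> by (meson finite_Pow_iff finite_subset)
  have deg: "degree_of (insert {u, v} E) x = (if x \<in> {u, v} then Suc (degree_of E x) else degree_of E x)"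
    for x
  proof -
    have "{d \<in> insert {u, v} E. x \<in> d} =
        (if x \<in> {u, v} then insert {u, v} {d \<in> E. x \<in> d} else {d \<in> E. x \<in> d})"
      by auto
    then show ?thesis
      using \<open>finite E\<close> assms(4) by (simp add: degree_of_def)
  qed
  have g: "(\<lambda>x. [:- real (degree_of (insert {u, v} E) x), 1:]) = g"
    using assms(3) by (auto simp: fun_eq_iff g_def f'_def f_def deg one_pCons)
  have p: "p = weighted_matching_poly f E"
    by (simp add: p_def f_def[abs_def])
  have sg: "simple_graph V (insert {u, v} E)"
    using assms by (auto simp: simple_graph_def)
  have "laplacian_matching_poly V (insert {u, v} E) = weighted_matching_poly g (insert {u, v} E) V"
    unfolding laplacian_matching_poly_conv_weighted[OF sg] g ..
  also have "\<dots> = weighted_matching_poly g E V - weighted_matching_poly g E (V - {u, v})"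
    using assms \<open>finite V\<close> by (intro weighted_matching_poly_insert_edge) auto
  also have "weighted_matching_poly g E (V - {u, v}) = p (V - {u, v})"
    unfolding p by (intro weighted_matching_poly_cong) (auto simp: g_def f'_def)
  also have "weighted_matching_poly g E V =
      weighted_matching_poly f' E V - weighted_matching_poly f' E (V - {v})"
    unfolding g_def using assms \<open>finite V\<close> by (intro weighted_matching_poly_shift) auto
  also have "weighted_matching_poly f' E V = p V - p (V - {u})"
    unfolding f'_def p using assms \<open>finite V\<close> by (intro weighted_matching_poly_shift) auto
  also have "weighted_matching_poly f' E (V - {v}) = p (V - {v}) - p (V - {v} - {u})"
    unfolding f'_def p using assms \<open>finite V\<close> by (intro weighted_matching_poly_shift) auto
  also have "V - {v} - {u} = V - {u, v}"
    by auto
  finally show ?thesis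
    by simp
qed

text \<open>The first step of a path from \<open>u\<close> to \<open>v\<close> is an edge at
  \<open>u\<close>.\<close>

lemma connected_graph_degree_pos:
  assumes "simple_graph V E" "connected_graph V E" "u \<in> V" "v \<in> V" "u \<noteq> v"
  shows "degree_of E u > 0"
proof -
  have "(u, v) \<in> {(a, b). {a, b} \<in> E}\<^sup>*"
    using assms by (auto simp: connected_graph_def)
  then obtain w where "{u, w} \<in> E"
    using assms(5) by (auto elim: converse_rtranclE)
  moreover have "finite E"
    using assms(1) unfolding simple_graph_def
    by (metis (no_types, lifting) Collect_mono Pow_def finite_Pow_iff finite_subset)
  ultimately show ?thesis
    unfolding degree_of_def by (subst card_gt_0_iff) auto
qed

section \<open>Coefficient comparison for a variation in one place\<close>

theorem theorem3p1:
  fixes V :: "'a set" and E :: "'a set set" and e :: "'a set" and n :: nat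
    and ls :: "real list"
  assumes "simple_graph V E"
    and "connected_graph V E"
    and "card V = n"
    and "e \<subseteq> V" and "card e = 2" and "e \<notin> E"
    and "ls = laplacian_matching_roots V E"
  shows "\<not> (\<exists>t<n. mset (laplacian_matching_roots V (insert e E)) = mset (ls[t := ls ! t + 2]))"
proof
  assume "\<exists>t<n. mset (laplacian_matching_roots V (insert e E)) = mset (ls[t := ls ! t + 2])"
  then obtain t where t: "t < n"
    "mset (laplacian_matching_roots V (insert e E)) = mset (ls[t := ls ! t + 2])"
    by blast
  obtain u v where uv: "e = {u, v}" "u \<noteq> v"
    using assms(5) by (auto simp: card_2_iff)
  then have V: "u \<in> V" "v \<in> V"
    using assms(4) by auto
  have graph: "finite V" "\<And>d. d \<in> E \<Longrightarrow> card d = 2" "\<And>d. d \<in> E \<Longrightarrow> d \<subseteq> V"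
    using assms(1) by (auto simp: simple_graph_def)
  have sg: "simple_graph V (insert e E)"
    using assms by (auto simp: simple_graph_def)
  define p where "p = weighted_matching_poly (\<lambda>x. [:- real (degree_of E x), 1:]) E"
  define c where "c = ls ! t"
  \<comment> \<open>The unchanged roots give the common factor \<open>Q\<close> of the two Laplacian
    matching polynomials.\<close>
  define Q where "Q = (\<Prod>x\<in>#mset ls - {#c#}. [:-x, 1:])"
  have t_len: "t < length ls"
    using t(1) length_laplacian_matching_roots[OF assms(1)] assms by simp
  then have "c \<in># mset ls"
    by (simp add: c_def)
  then have "mset ls = add_mset c (mset ls - {#c#})"
    by simp
  then have "(\<Prod>x\<in>#mset ls. [:-x, 1:]) = [:- c, 1:] * Q"
    unfolding Q_def by (metis image_mset_add_mset prod_mset.add_mset)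
  then have pV: "p V = [:- c, 1:] * Q"
    using laplacian_matching_poly_eq_prod_roots[OF assms(1)] assms(7)
    by (simp only: p_def flip: laplacian_matching_poly_conv_weighted[OF assms(1)])
  have "laplacian_matching_poly V (insert e E) = [:- (c + 2), 1:] * Q"
    using laplacian_matching_poly_eq_prod_roots[OF sg] t(2) mset_update[OF t_len, of "c + 2"]
    by (simp add: Q_def c_def del: mult_pCons_left)
  then have "p V - p (V - {u}) - p (V - {v}) = [:- (c + 2), 1:] * Q"
    using laplacian_matching_poly_insert_edge[of V E u v] assms uv by (simp add: p_def)
  \<comment> \<open>The linear cofactors of \<open>Q\<close> before and after adding
    \<open>e\<close> differ by the constant 2.\<close>
  then have sum: "p (V - {u}) + p (V - {v}) = smult 2 Q"
    unfolding pV by (simp add: algebra_simps poly_eq_iff)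
  have "n \<ge> 2"
    using card_mono[OF graph(1) assms(4)] assms by simp
  \<comment> \<open>Deleting one vertex leaves degree \<open>Suc k\<close> and deleting the two ends
    of an edge leaves degree \<open>k\<close>, so these are the two coefficients to compare.\<close>
  then obtain k where k: "n = Suc (Suc k)"
    by (metis add_2_eq_Suc le_Suc_ex)
  define S where "S x = (\<Sum>d\<in>{d \<in> E. x \<in> d}. p (V - d))" for x
  have vertex: "p V = [:- real (degree_of E x), 1:] * p (V - {x}) - S x" if "x \<in> V" for x
  proof -
    have "{d \<in> E. d \<subseteq> V \<and> x \<in> d} = {d \<in> E. x \<in> d}"
      using graph(3) by auto
    then show ?thesis
      using weighted_matching_poly_vertex[OF graph(1) that,
          of "\<lambda>x. [:- real (degree_of E x), 1:]" E]
      by (simp only: p_def S_def)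
  qed
  have monic: "degree (p A) = card A" "coeff (p A) (card A) = 1" if "finite A" for A
    using monic_weighted_matching_poly[OF that graph(2)] by (simp_all add: p_def)
  have coeff_deleted: "coeff (p (V - {x})) (Suc k) = 1" if "x \<in> V" for x
    using monic(2)[of "V - {x}"] graph(1) assms(3) k that by simp
  have coeff_S: "coeff (S x) (Suc k) = 0" "coeff (S x) k = degree_of E x" for x
  proof -
    have "card (V - d) = k" if "d \<in> E" for d
      using card_Diff_subset[of d V] graph(1) graph(2,3)[of d] assms(3) k that by (auto intro: finite_subset)
    then have "coeff (p (V - d)) (Suc k) = 0" "coeff (p (V - d)) k = 1" if "d \<in> E" for d
      using monic[of "V - d"] graph(1) that by (auto intro: coeff_eq_0)
    then show "coeff (S x) (Suc k) = 0" "coeff (S x) k = degree_of E x"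
      by (simp_all add: S_def coeff_sum degree_of_def)
  qed
  \<comment> \<open>Read off at \<open>Suc k\<close> in the recursion at \<open>x\<close>, where
    \<open>p (V - {x})\<close> has coefficient 1 and \<open>S x\<close> contributes nothing.\<close>
  have coeff_next: "coeff (p (V - {x})) k = coeff (p V) (Suc k) + degree_of E x" if "x \<in> V" for x
    using arg_cong[OF vertex[OF that], of "\<lambda>q. coeff q (Suc k)"] coeff_deleted[OF that] coeff_S(1)
    by simp
  \<comment> \<open>Twice \<open>p V\<close> is computed in two ways: as \<open>[:- c, 1:]\<close>
    times \<open>p (V - {u}) + p (V - {v})\<close>, and as the sum of the recursions at
    \<open>u\<close> and at \<open>v\<close>. The terms multiplied by the variable cancel.\<close>
  have balance: "(degree_of E u - c) * coeff (p (V - {u})) i + coeff (S u) i +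
      ((degree_of E v - c) * coeff (p (V - {v})) i + coeff (S v) i) = 0" for i
  proof -
    define X where "X = [:0, 1 :: real:]"
    have lin: "[:- a, 1:] * q = X * q - smult a q" for a q
      by (simp add: X_def)
    have "p V + p V = smult 2 (p V)"
      by (rule poly_eqI) (simp only: coeff_add coeff_smult mult_2)
    also have "\<dots> = X * smult 2 Q - smult c (smult 2 Q)"
      unfolding pV lin by (simp add: smult_diff_right mult.commute)
    finally have "p V + p V = X * p (V - {u}) + X * p (V - {v}) - smult c (p (V - {u}) + p (V - {v}))"
      unfolding sum[symmetric] by (simp add: algebra_simps)
    moreover have "p V + p V = (X * p (V - {u}) - smult (degree_of E u) (p (V - {u})) - S u) +
        (X * p (V - {v}) - smult (degree_of E v) (p (V - {v})) - S v)"
      using vertex[OF V(1)] vertex[OF V(2)] unfolding lin by metis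
    ultimately have "smult c (p (V - {u}) + p (V - {v})) =
        smult (degree_of E u) (p (V - {u})) + S u + smult (degree_of E v) (p (V - {v})) + S v"
      by (simp add: algebra_simps)
    from arg_cong[OF this, of "\<lambda>q. coeff q i"] show ?thesis
      by (simp add: algebra_simps)
  qed
  define a b where "a = real (degree_of E u)" and "b = real (degree_of E v)"
  \<comment> \<open>At \<open>Suc k\<close> both deleted polynomials have coefficient 1 and the edge
    sums vanish.\<close>
  have c: "a + b = 2 * c"
    using balance[of "Suc k"] by (simp add: coeff_deleted V coeff_S a_def b_def)
  define m where "m = coeff (p V) (Suc k)"
  have "(a - c) * (m + a) + a + ((b - c) * (m + b) + b) = 0"
    using balance[of k] by (simp add: coeff_next V coeff_S a_def b_def m_def)
  moreover have "b = 2 * c - a"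
    using c by simp
  \<comment> \<open>Since \<open>b - c = - (a - c)\<close>, the unknown \<open>m\<close> cancels and
    the products leave \<open>(a - c) * (a - b)\<close>, which is twice a square. Positive degrees
    make \<open>c\<close> positive, so the sum cannot vanish.\<close>
  ultimately have "2 * (a - c)\<^sup>2 + 2 * c = 0"
    by (simp add: algebra_simps power2_eq_square)
  moreover have "a > 0" "b > 0"
    using connected_graph_degree_pos[OF assms(1,2)] V uv(2) by (auto simp: a_def b_def)
  ultimately show False
    using c zero_le_power2[of "a - c"] by linarith
qed

end
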